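(* Let $X$ be a Banach space over $\mathbb{K}\in\{\mathbb{R},\mathbb{C}\}$, let $\Lambda$ be a nonempty set, let $X_\lambda$, $\lambda\in\Lambda$, be closed linear subspaces of $X$ forming an absolutely representing family of subspaces (ARFS) in $X$, and let $\Lambda'$ be a subset of $\Lambda$. Suppose that (1) $\Lambda'$ is finite; (2) $X_\lambda$ is finite dimensional for every $\lambda\in\Lambda'$. Then the family $(X_\lambda)_{\lambda\in\Lambda\setminus\Lambda'}$ is an ARFS in $X$ if and only if $\mathcal{L}(X_\lambda\mid\lambda\in\Lambda\setminus\Lambda')$ is dense in $X$.
   Context: A family $(X_\lambda)_{\lambda\in\Lambda}$ of closed linear subspaces of $X$ is called an absolutely representing family of subspaces (ARFS) in $X$ if for every $x\in X$ there exist $x_\lambda\in X_\lambda$, $\lambda\in\Lambda$, such that $\sum_{\lambda\in\Lambda}\|x_\lambda\|<\infty$ and $x=\sum_{\lambda\in\Lambda}x_\lambda$ (an empty sum is $0$). $\mathcal{L}(X_\lambda\mid\lambda\in\Lambda\setminus\Lambda')$ is the (algebraic) linear span of $\bigcup_{\lambda\in\Lambda\setminus\Lambda'}X_\lambda$ (equal to $\{0\}$ if $\Lambda\setminus\Lambda'=\varnothing$). *)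

theory Defs
  imports "HOL-Analysis.Analysis"
begin

text \<open>
  The scalar field is a type of sort \<open>{real_normed_field, euclidean_space}\<close>. Both \<open>real\<close> and
  \<open>complex\<close> have this sort, and up to isometric isomorphism they are the only fields that do: such
  a field is a finite-dimensional extension of the reals with a multiplicative norm. As the
  libraries have no class of complex Banach spaces, the scalar multiplication is an explicit
  parameter. The class \<open>banach\<close> provides the norm, completeness and the underlying real structure,
  which \<open>scale\<close> extends.
\<close>

locale banach_space_over = vector_space scale
  for scale :: "'k::{real_normed_field, euclidean_space} \<Rightarrow> 'a::banach \<Rightarrow> 'a" +
  assumes scale_of_real: "scale (of_real r) x = r *\<^sub>R x"
    and norm_scale: "norm (scale c x) = norm c * norm x"
begin

definition closed_subspace :: "'a set \<Rightarrow> bool" where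
  "closed_subspace S \<longleftrightarrow> subspace S \<and> closed S"

definition finite_dimensional :: "'a set \<Rightarrow> bool" where
  "finite_dimensional S \<longleftrightarrow> (\<exists>B. finite B \<and> span B = S)"

text \<open>
  The sums range over an arbitrary, possibly uncountable, index set and are unordered.
\<close>

definition ARFS :: "('i \<Rightarrow> 'a set) \<Rightarrow> 'i set \<Rightarrow> bool" where
  "ARFS X \<Lambda> \<longleftrightarrow> (\<forall>l\<in>\<Lambda>. closed_subspace (X l)) \<and>
     (\<forall>v. \<exists>x. (\<forall>l\<in>\<Lambda>. x l \<in> X l) \<and> (\<lambda>l. norm (x l)) summable_on \<Lambda> \<and> (x has_sum v) \<Lambda>)"

end

lemma banach_space_over_scaleR:
  "banach_space_over ((*\<^sub>R) :: real \<Rightarrow> 'a::banach \<Rightarrow> 'a)"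
  by unfold_locales (auto simp: algebra_simps)

lemma banach_space_over_complex:
  "banach_space_over ((*) :: complex \<Rightarrow> complex \<Rightarrow> complex)"
  by unfold_locales (auto simp: algebra_simps norm_mult scaleR_conv_of_real)

end

theory Submission
  imports Defs
begin

text \<open>
  Let \<open>R\<close> be the set of all absolutely convergent sums over \<open>\<Lambda> - \<Lambda>'\<close>, let \<open>R\<^sub>n\<close> consist of those with
  \<open>\<Sum> \<parallel>x\<^sub>l\<parallel> \<le> n\<close>, and let the finite set \<open>B\<close> span the spaces of \<open>\<Lambda>'\<close>. Every vector lies in \<open>R + span B\<close>,
  so by Baire's theorem the closure of the set of vectors \<open>s + (\<Sum>b\<in>B. c\<^sub>b b)\<close> with \<open>s \<in> R\<^sub>n\<close> and
  \<open>\<bar>c\<^sub>b\<bar> \<le> n\<close> has an interior point for some \<open>n\<close>. Differences of such vectors approximate every vector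
  of some ball of radius \<open>r\<close> around \<open>0\<close>. If \<open>R\<close> is dense, each \<open>b\<close> can be replaced by a nearby element
  of \<open>R\<close>, so for some \<open>M\<close> every vector of the ball is within \<open>r / 2\<close> of \<open>R\<^sub>M\<close>. Iterating, as in the
  proof of the open mapping theorem, shows that the ball is contained in \<open>R\<close>.
\<close>

section \<open>Absolutely convergent sums of bounded total norm\<close>

text \<open>A quantitative form of the representations in \<open>ARFS\<close>: the bound
  \<open>M\<close> is what Baire's theorem and the geometric iteration keep under control. The sum
  \<open>m\<close> of the norms need only stay below \<open>M\<close>, so the sets increase with
  \<open>M\<close>.\<close>

definition abs_sums :: "('i \<Rightarrow> 'a::real_normed_vector set) \<Rightarrow> 'i set \<Rightarrow> real \<Rightarrow> 'a set" where
  "abs_sums X I M = {v. \<exists>x m. (\<forall>l\<in>I. x l \<in> X l) \<and> ((\<lambda>l. norm (x l)) has_sum m) I \<and> m \<le> M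
     \<and> (x has_sum v) I}"

lemma abs_sumsI:
  assumes "\<And>l. l \<in> I \<Longrightarrow> x l \<in> X l" "((\<lambda>l. norm (x l)) has_sum m) I" "m \<le> M" "(x has_sum v) I"
  shows "v \<in> abs_sums X I M"
  using assms unfolding abs_sums_def by blast

lemma abs_sums_mono: "M \<le> N \<Longrightarrow> abs_sums X I M \<subseteq> abs_sums X I N"
  unfolding abs_sums_def by fastforce

text \<open>By completeness an absolutely summable family is summable on every subset, so
  restricting a representation to \<open>I - J\<close> and to \<open>J\<close> gives the two
  summands.\<close>

lemma abs_sums_split:
  fixes X :: "'i \<Rightarrow> 'a::banach set"
  assumes "J \<subseteq> I" "v \<in> abs_sums X I M"
  obtains s t N N' where "v = s + t" "s \<in> abs_sums X (I - J) N" "t \<in> abs_sums X J N'"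
proof -
  obtain x where x: "\<forall>l\<in>I. x l \<in> X l" "(\<lambda>l. norm (x l)) summable_on I" "(x has_sum v) I"
    using assms(2) unfolding abs_sums_def summable_on_def by blast
  have part: "infsum x K \<in> abs_sums X K (\<Sum>\<^sub>\<infinity>l\<in>K. norm (x l))" "(x has_sum infsum x K) K"
    if "K \<subseteq> I" for K
  proof -
    have s: "(\<lambda>l. norm (x l)) summable_on K"
      using x(2) that by (rule summable_on_subset_banach)
    show "(x has_sum infsum x K) K"
      by (rule has_sum_infsum[OF Infinite_Sum.abs_summable_summable[OF s]])
    then show "infsum x K \<in> abs_sums X K (\<Sum>\<^sub>\<infinity>l\<in>K. norm (x l))"
      using x(1) that has_sum_infsum[OF s] by (intro abs_sumsI[of K x]) auto
  qed
  have "(x has_sum (infsum x (I - J) + infsum x J)) ((I - J) \<union> J)"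
    by (rule has_sum_Un_disjoint) (use part(2) assms(1) in auto)
  moreover have "(I - J) \<union> J = I"
    using assms(1) by blast
  ultimately have "v = infsum x (I - J) + infsum x J"
    using x(3) has_sum_unique by metis
  then show thesis
    using part(1)[OF Diff_subset] part(1)[OF assms(1)] by (rule that)
qed

text \<open>If every \<open>closure (A n)\<close> had empty interior, then by Baire's theorem so
  would their union, which is the whole space.\<close>

lemma Baire_covering:
  fixes A :: "nat \<Rightarrow> 'a::complete_space set"
  assumes "(\<Union>n. A n) = UNIV"
  obtains n a r where "r > 0" "ball a r \<subseteq> closure (A n)"
proof -
  have "\<exists>n. interior (closure (A n)) \<noteq> {}"
  proof (rule ccontr)
    assume "\<not> ?thesis"
    then have "euclidean interior_of \<Union>(range (\<lambda>n. closure (A n))) = {}"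
      by (intro Baire_category_alt) (auto simp: completely_metrizable_space_euclidean)
    moreover have "(\<Union>n. closure (A n)) = UNIV"
      using assms closure_subset by blast
    ultimately show False
      by simp
  qed
  then show thesis
    using that by (metis ex_in_conv mem_interior)
qed

section \<open>Linear operations on the sums\<close>

context banach_space_over
begin

lemma ARFS_iff_abs_sums:
  "ARFS X I \<longleftrightarrow> (\<forall>l\<in>I. closed_subspace (X l)) \<and> (\<Union>M. abs_sums X I M) = UNIV"
proof -
  have "(\<exists>x. (\<forall>l\<in>I. x l \<in> X l) \<and> (\<lambda>l. norm (x l)) summable_on I \<and> (x has_sum v) I) \<longleftrightarrow>
    (\<exists>M. v \<in> abs_sums X I M)" for v
    unfolding abs_sums_def summable_on_def by blast
  then show ?thesis
    by (simp add: ARFS_def set_eq_iff)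
qed

text \<open>Allows \<open>scale c\<close> to be moved through infinite sums. Real homogeneity holds
  because \<open>r\<close> acts as \<open>of_real r\<close> and scalars commute.\<close>

lemma bounded_linear_scale: "bounded_linear (scale c)"
proof (rule bounded_linear_intro[where K = "norm c"])
  show "scale c (r *\<^sub>R x) = r *\<^sub>R scale c x" for r x
    by (simp flip: scale_of_real add: scale_left_commute)
qed (simp_all add: scale_right_distrib norm_scale)

lemma abs_sums_finite:
  assumes X: "\<And>l. l \<in> I \<Longrightarrow> subspace (X l)" and F: "finite F" "F \<subseteq> I"
    and x: "\<And>l. l \<in> F \<Longrightarrow> x l \<in> X l"
  shows "(\<Sum>l\<in>F. x l) \<in> abs_sums X I (\<Sum>l\<in>F. norm (x l))"
proof -
  \<comment> \<open>Extension by zero is admissible because every \<open>X l\<close> contains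
    \<open>0\<close>.\<close>
  define y where "y l = (if l \<in> F then x l else 0)" for l
  have "(y has_sum (\<Sum>l\<in>F. x l)) I"
    by (rule has_sum_finite_neutralI[OF F]) (auto simp: y_def)
  moreover have "((\<lambda>l. norm (y l)) has_sum (\<Sum>l\<in>F. norm (x l))) I"
    by (rule has_sum_finite_neutralI[OF F]) (auto simp: y_def)
  moreover have "\<forall>l\<in>I. y l \<in> X l"
    using x X subspace_0 by (auto simp: y_def)
  ultimately show ?thesis
    unfolding abs_sums_def by blast
qed

lemma abs_sums_zero: "(\<And>l. l \<in> I \<Longrightarrow> subspace (X l)) \<Longrightarrow> 0 \<in> abs_sums X I 0"
  using abs_sums_finite[of I X "{}"] by simp

lemma abs_sums_add:
  assumes X: "\<And>l. l \<in> I \<Longrightarrow> subspace (X l)"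
    and v: "v \<in> abs_sums X I M" and w: "w \<in> abs_sums X I N"
  shows "v + w \<in> abs_sums X I (M + N)"
proof -
  obtain x m where x: "\<forall>l\<in>I. x l \<in> X l" "((\<lambda>l. norm (x l)) has_sum m) I" "m \<le> M" "(x has_sum v) I"
    using v unfolding abs_sums_def by blast
  obtain y n where y: "\<forall>l\<in>I. y l \<in> X l" "((\<lambda>l. norm (y l)) has_sum n) I" "n \<le> N" "(y has_sum w) I"
    using w unfolding abs_sums_def by blast
  have s: "((\<lambda>l. norm (x l) + norm (y l)) has_sum (m + n)) I"
    using x y by (intro has_sum_add)
  have "(\<lambda>l. norm (x l + y l)) summable_on I"
    by (rule summable_on_comparison_test[of "\<lambda>l. norm (x l) + norm (y l)"])
      (use s in \<open>auto simp: summable_on_def norm_triangle_ineq\<close>)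
  then obtain k where k: "((\<lambda>l. norm (x l + y l)) has_sum k) I"
    unfolding summable_on_def by blast
  have "k \<le> m + n"
    by (rule has_sum_mono[OF k s]) (rule norm_triangle_ineq)
  then have "k \<le> M + N"
    using x y by linarith
  moreover have "((\<lambda>l. x l + y l) has_sum (v + w)) I"
    using x y by (intro has_sum_add)
  moreover have "\<forall>l\<in>I. x l + y l \<in> X l"
    using x y X subspace_add by blast
  ultimately show ?thesis
    using k by (intro abs_sumsI[of I "\<lambda>l. x l + y l"]) auto
qed

lemma abs_sums_scale:
  assumes X: "\<And>l. l \<in> I \<Longrightarrow> subspace (X l)" and v: "v \<in> abs_sums X I M"
  shows "scale c v \<in> abs_sums X I (norm c * M)"
proof -
  obtain x m where x: "\<forall>l\<in>I. x l \<in> X l" "((\<lambda>l. norm (x l)) has_sum m) I" "m \<le> M" "(x has_sum v) I"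
    using v unfolding abs_sums_def by blast
  have "((\<lambda>l. norm (scale c (x l))) has_sum (norm c * m)) I"
    unfolding norm_scale using x by (intro has_sum_cmult_right)
  moreover have "((\<lambda>l. scale c (x l)) has_sum (scale c v)) I"
    by (rule has_sum_bounded_linear[OF bounded_linear_scale x(4)])
  moreover have "\<forall>l\<in>I. scale c (x l) \<in> X l"
    using x X subspace_scale by blast
  moreover have "norm c * m \<le> norm c * M"
    using x by (simp add: mult_left_mono)
  ultimately show ?thesis
    by (intro abs_sumsI[of I "\<lambda>l. scale c (x l)"]) auto
qed

lemma abs_sums_scaleR:
  assumes "\<And>l. l \<in> I \<Longrightarrow> subspace (X l)" "v \<in> abs_sums X I M"
  shows "r *\<^sub>R v \<in> abs_sums X I (\<bar>r\<bar> * M)"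
  using abs_sums_scale[OF assms, of "of_real r"] by (simp add: scale_of_real)

lemma abs_sums_diff:
  assumes "\<And>l. l \<in> I \<Longrightarrow> subspace (X l)" "v \<in> abs_sums X I M" "w \<in> abs_sums X I N"
  shows "v - w \<in> abs_sums X I (M + N)"
  using abs_sums_add[OF assms(1,2) abs_sums_scaleR[OF assms(1,3), of "-1"]] by simp

lemma abs_sums_lincomb:
  assumes X: "\<And>l. l \<in> I \<Longrightarrow> subspace (X l)" and "finite B"
    and "\<And>b. b \<in> B \<Longrightarrow> y b \<in> abs_sums X I (N b)"
  shows "(\<Sum>b\<in>B. scale (c b) (y b)) \<in> abs_sums X I (\<Sum>b\<in>B. norm (c b) * N b)"
  using assms(2,3)
  by (induction B rule: finite_induct) (auto intro!: abs_sums_zero abs_sums_add abs_sums_scale X)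

section \<open>Series and successive approximation\<close>

text \<open>The representations of the \<open>v k\<close> form a double family whose norms sum to at
  most \<open>m\<close>. Absolute summability permits summing over \<open>k\<close> first, and
  closedness of \<open>X l\<close> keeps these inner sums in \<open>X l\<close>.\<close>

lemma abs_sums_series:
  fixes v :: "nat \<Rightarrow> 'a"
  assumes X: "\<And>l. l \<in> I \<Longrightarrow> closed_subspace (X l)"
    and v: "\<And>k. v k \<in> abs_sums X I (M k)" and M: "M sums m" and w: "v sums w"
  shows "w \<in> abs_sums X I m"
proof -
  obtain x n where x: "\<And>k l. l \<in> I \<Longrightarrow> x k l \<in> X l"
    "\<And>k. ((\<lambda>l. norm (x k l)) has_sum n k) I" "\<And>k. n k \<le> M k" "\<And>k. (x k has_sum v k) I"
    using v unfolding abs_sums_def by simp metis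
  \<comment> \<open>Since \<open>n k\<close> is at most \<open>M k\<close>, the terms
    \<open>M k\<close> are nonnegative too, and the series of \<open>M\<close> converges
    unconditionally.\<close>
  have n0: "0 \<le> n k" for k
    using x(2) by (rule has_sum_nonneg) simp
  have M': "(M has_sum m) UNIV"
    using M n0 x(3) by (intro sums_nonneg_imp_has_sum) (auto intro: order_trans)
  have n: "n summable_on UNIV"
    by (rule summable_on_comparison_test[of M]) (use M' n0 x(3) in \<open>auto simp: summable_on_def\<close>)
  have vn: "norm (v k) \<le> n k" for k
    using x(4,2) by (rule norm_infsum_le) simp
  have "summable (\<lambda>k. norm (v k))"
    by (rule summable_comparison_test[OF _ summable_on_imp_summable[OF n]]) (simp add: vn)
  then have w': "(v has_sum w) UNIV"
    using w by (rule norm_summable_imp_has_sum)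
  have abs: "(\<lambda>p. norm (case p of (k, l) \<Rightarrow> x k l)) summable_on (UNIV \<times> I)"
    using x(2) n by (intro summable_on_SigmaI) auto
  have tot: "((\<lambda>(k, l). x k l) has_sum w) (UNIV \<times> I)"
    by (rule has_sum_SigmaI[where g = v]) (use x(4) w' Infinite_Sum.abs_summable_summable[OF abs] in auto)
  have absn: "((\<lambda>(k, l). norm (x k l)) has_sum infsum n UNIV) (UNIV \<times> I)"
    by (rule has_sum_SigmaI[where g = n])
      (use x(2) n abs in \<open>auto simp: case_prod_unfold has_sum_infsum\<close>)
  have tot': "((\<lambda>(l, k). x k l) has_sum w) (I \<times> UNIV)"
    using tot by (subst has_sum_swap) simp
  have absn': "((\<lambda>(l, k). norm (x k l)) has_sum infsum n UNIV) (I \<times> UNIV)"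
    using absn by (subst has_sum_swap) simp
  have abs_l: "(\<lambda>k. norm (x k l)) summable_on UNIV" if "l \<in> I" for l
    by (rule summable_on_SigmaD1[OF has_sum_imp_summable[OF absn'] that])
  define z where "z l = (\<Sum>\<^sub>\<infinity>k. x k l)" for l
  have z: "((\<lambda>k. x k l) has_sum z l) UNIV" if "l \<in> I" for l
    unfolding z_def by (rule has_sum_infsum[OF Infinite_Sum.abs_summable_summable[OF abs_l[OF that]]])
  have "z l \<in> X l" if l: "l \<in> I" for l
  proof (rule closed_sequentially)
    show "closed (X l)"
      using X[OF l] by (simp add: closed_subspace_def)
    show "(\<Sum>k<N. x k l) \<in> X l" for N
      using X[OF l] x(1)[OF l] by (auto simp: closed_subspace_def intro: subspace_sum)
    show "(\<lambda>N. \<Sum>k<N. x k l) \<longlonglongrightarrow> z l"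
      using has_sum_imp_sums[OF z[OF l]] by (simp add: sums_def)
  qed
  moreover have "(z has_sum w) I"
    by (rule has_sum_SigmaD[OF tot']) (simp add: z)
  moreover have s: "((\<lambda>l. \<Sum>\<^sub>\<infinity>k. norm (x k l)) has_sum infsum n UNIV) I"
    by (rule has_sum_SigmaD[OF absn']) (simp add: abs_l)
  moreover have le: "norm (z l) \<le> (\<Sum>\<^sub>\<infinity>k. norm (x k l))" if "l \<in> I" for l
    unfolding z_def using abs_l[OF that] by (rule norm_infsum_bound)
  have "(\<lambda>l. norm (z l)) summable_on I"
    by (rule summable_on_comparison_test[of "\<lambda>l. \<Sum>\<^sub>\<infinity>k. norm (x k l)"])
      (use s le in \<open>auto simp: summable_on_def\<close>)
  then obtain q where q: "((\<lambda>l. norm (z l)) has_sum q) I"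
    unfolding summable_on_def by blast
  moreover have "q \<le> infsum n UNIV"
    by (rule has_sum_mono[OF q s le])
  moreover have "infsum n UNIV \<le> m"
    by (rule has_sum_mono[OF has_sum_infsum[OF n] M' x(3)])
  ultimately show ?thesis
    by (intro abs_sumsI[of I z X q]) auto
qed

text \<open>Approximating a vector of the ball leaves an error below \<open>r / 2\<close>; doubled,
  it lies in the ball again and can be approximated in turn. Undoing the doublings writes
  \<open>u\<close> as a series with weights \<open>(1 / 2) ^ k\<close>, so the bounds add up to
  \<open>2 * M\<close>.\<close>

lemma ball_subset_abs_sums:
  assumes X: "\<And>l. l \<in> I \<Longrightarrow> closed_subspace (X l)"
    and approx: "\<And>v. norm v < r \<Longrightarrow> \<exists>s\<in>abs_sums X I M. norm (v - s) < r / 2"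
    and u: "norm u < r"
  shows "u \<in> abs_sums X I (2 * M)"
proof -
  obtain f where f: "\<And>v. norm v < r \<Longrightarrow> f v \<in> abs_sums X I M"
    "\<And>v. norm v < r \<Longrightarrow> norm (v - f v) < r / 2"
    using approx by metis
  \<comment> \<open>\<open>e k\<close> is the error after \<open>k\<close> approximations, magnified
    by \<open>2 ^ k\<close>.\<close>
  define e where "e = rec_nat u (\<lambda>_ v. 2 *\<^sub>R (v - f v))"
  have e: "e 0 = u" "e (Suc k) = 2 *\<^sub>R (e k - f (e k))" for k
    by (simp_all add: e_def)
  have er: "norm (e k) < r" for k
  proof (induction k)
    case (Suc k)
    then show ?case
      using f(2)[of "e k"] by (simp add: e)
  qed (simp add: e u)
  \<comment> \<open>The sum telescopes: its \<open>k\<close>-th term is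
    \<open>(1 / 2) ^ k *\<^sub>R e k\<close> minus the same expression for
    \<open>Suc k\<close>.\<close>
  have part: "(\<Sum>k<n. (1 / 2) ^ k *\<^sub>R f (e k)) = u - (1 / 2) ^ n *\<^sub>R e n" for n
    by (induction n) (simp_all add: e algebra_simps)
  have "(\<lambda>n. (1 / 2) ^ n *\<^sub>R e n) \<longlonglongrightarrow> 0"
  proof (rule Lim_null_comparison)
    show "\<forall>\<^sub>F n in sequentially. norm ((1 / 2) ^ n *\<^sub>R e n) \<le> (1 / 2) ^ n * r"
      using er by (intro always_eventually) (simp add: less_imp_le divide_right_mono power_divide)
    show "(\<lambda>n. (1 / 2) ^ n * r) \<longlonglongrightarrow> 0"
      by (intro tendsto_mult_left_zero LIMSEQ_power_zero) simp
  qed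
  then have "(\<lambda>n. u - (1 / 2) ^ n *\<^sub>R e n) \<longlonglongrightarrow> u"
    using tendsto_diff[OF tendsto_const, of _ 0 sequentially u] by simp
  then have u': "(\<lambda>k. (1 / 2) ^ k *\<^sub>R f (e k)) sums u"
    by (simp add: sums_def part)
  have M: "(\<lambda>k. (1 / 2) ^ k * M) sums (2 * M)"
    using sums_mult2[OF geometric_sums[of "1 / 2 :: real"], of M] by simp
  have fe: "(1 / 2) ^ k *\<^sub>R f (e k) \<in> abs_sums X I ((1 / 2) ^ k * M)" for k
    using abs_sums_scaleR[OF _ f(1)[OF er], of "(1 / 2) ^ k" k] X by (simp add: closed_subspace_def)
  show ?thesis
    by (rule abs_sums_series[OF X fe M u'])
qed

section \<open>Comparison with linear spans\<close>

lemma span_subset_abs_sums: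
  assumes X: "\<And>l. l \<in> I \<Longrightarrow> subspace (X l)"
  shows "span (\<Union>l\<in>I. X l) \<subseteq> (\<Union>M. abs_sums X I M)"
proof (rule span_minimal)
  show "(\<Union>l\<in>I. X l) \<subseteq> (\<Union>M. abs_sums X I M)"
  proof
    fix v assume "v \<in> (\<Union>l\<in>I. X l)"
    then obtain l where "l \<in> I" "v \<in> X l"
      by blast
    then have "v \<in> abs_sums X I (norm v)"
      using abs_sums_finite[of I X "{l}" "\<lambda>_. v"] X by simp
    then show "v \<in> (\<Union>M. abs_sums X I M)"
      by blast
  qed
  show "subspace (\<Union>M. abs_sums X I M)"
  proof (rule subspaceI)
    show "0 \<in> (\<Union>M. abs_sums X I M)"
      using abs_sums_zero[of I X] X by blast
    show "v + w \<in> (\<Union>M. abs_sums X I M)"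
      if "v \<in> (\<Union>M. abs_sums X I M)" "w \<in> (\<Union>M. abs_sums X I M)" for v w
      using that abs_sums_add[of I X] X by blast
    show "scale c v \<in> (\<Union>M. abs_sums X I M)" if "v \<in> (\<Union>M. abs_sums X I M)" for c v
      using that abs_sums_scale[of I X] X by blast
  qed
qed

text \<open>The finite partial sums lie in the span and approximate \<open>v\<close>. This gives the
  necessity of density.\<close>

lemma abs_sums_subset_closure_span: "abs_sums X I M \<subseteq> closure (span (\<Union>l\<in>I. X l))"
proof
  fix v assume "v \<in> abs_sums X I M"
  then obtain x where x: "\<forall>l\<in>I. x l \<in> X l" "(x has_sum v) I"
    unfolding abs_sums_def by blast
  have "sum x F \<in> span (\<Union>l\<in>I. X l)" if "F \<subseteq> I" for F
    using x that by (intro span_sum span_base) auto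
  then show "v \<in> closure (span (\<Union>l\<in>I. X l))"
    unfolding closure_approachable_le
    using has_sum_finite_approximation[OF x(2)] by blast
qed

text \<open>Over a finite index set the sums are finite, so the union of finite generating sets of
  the \<open>X l\<close> serves as \<open>B\<close>.\<close>

lemma finite_dimensional_abs_sums_subset:
  assumes "finite J" "\<And>l. l \<in> J \<Longrightarrow> finite_dimensional (X l)"
  obtains B where "finite B" "(\<Union>M. abs_sums X J M) \<subseteq> span B"
proof -
  obtain B where B: "\<And>l. l \<in> J \<Longrightarrow> finite (B l) \<and> span (B l) = X l"
    using assms(2) unfolding finite_dimensional_def by metis
  show thesis
  proof
    show "finite (\<Union>l\<in>J. B l)"
      using assms(1) B by blast
    show "(\<Union>M. abs_sums X J M) \<subseteq> span (\<Union>l\<in>J. B l)"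
    proof
      fix v assume "v \<in> (\<Union>M. abs_sums X J M)"
      then obtain x where x: "\<forall>l\<in>J. x l \<in> X l" "(x has_sum v) J"
        unfolding abs_sums_def by blast
      then have "v = sum x J"
        using assms(1) has_sum_unique has_sum_finite by blast
      also have "x l \<in> span (\<Union>l\<in>J. B l)" if "l \<in> J" for l
        using x(1) B[OF that] that span_mono[of "B l" "\<Union>l\<in>J. B l"] by blast
      then have "sum x J \<in> span (\<Union>l\<in>J. B l)"
        by (intro span_sum)
      finally show "v \<in> span (\<Union>l\<in>J. B l)" .
    qed
  qed
qed

section \<open>From density to representing every vector\<close>

text \<open>Baire's theorem bounds the sums and the coefficients on \<open>B\<close> simultaneously.
  As \<open>B\<close> is finite, one choice of approximants to its elements then serves for the
  whole ball, at a uniform cost \<open>K\<close>.\<close>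

lemma dense_abs_sums_eq_UNIV:
  assumes X: "\<And>l. l \<in> I \<Longrightarrow> closed_subspace (X l)" and B: "finite B"
    and cover: "\<And>v. \<exists>s M. s \<in> abs_sums X I M \<and> v - s \<in> span B"
    and dense: "closure (\<Union>M. abs_sums X I M) = UNIV"
  shows "(\<Union>M. abs_sums X I M) = UNIV"
proof -
  have X': "\<And>l. l \<in> I \<Longrightarrow> subspace (X l)"
    using X by (simp add: closed_subspace_def)
  define A where "A n = {s + (\<Sum>b\<in>B. scale (c b) b) | s c.
    s \<in> abs_sums X I (real n) \<and> (\<forall>b\<in>B. norm (c b) \<le> real n)}" for n
  have "v \<in> (\<Union>n. A n)" for v
  proof -
    obtain s M where s: "s \<in> abs_sums X I M" "v - s \<in> span B"
      using cover by blast
    then obtain c where c: "v - s = (\<Sum>b\<in>B. scale (c b) b)"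
      using span_finite[OF B] by auto
    obtain n where "max M (\<Sum>b\<in>B. norm (c b)) \<le> real n"
      using real_arch_simple by blast
    then have n: "M \<le> real n" "(\<Sum>b\<in>B. norm (c b)) \<le> real n"
      by auto
    have "s \<in> abs_sums X I (real n)"
      using s(1) abs_sums_mono[OF n(1)] by blast
    moreover have "norm (c b) \<le> real n" if "b \<in> B" for b
      using member_le_sum[OF that, of "\<lambda>b. norm (c b)"] B n(2) by simp
    moreover have "v = s + (\<Sum>b\<in>B. scale (c b) b)"
      using c by (simp add: algebra_simps)
    ultimately show ?thesis
      unfolding A_def by blast
  qed
  then have "(\<Union>n. A n) = UNIV"
    by blast
  then obtain n a r where r: "r > 0" "ball a r \<subseteq> closure (A n)"
    by (rule Baire_covering)
  \<comment> \<open>Chosen so that moving each element of \<open>B\<close> by less than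
    \<open>d\<close>, with coefficients of norm at most \<open>2 * real n\<close>, changes a
    combination by at most \<open>r / 4\<close>. The added ones keep the denominator positive for
    \<open>n = 0\<close> or empty \<open>B\<close>.\<close>
  define d where "d = r / (8 * (real n + 1) * (real (card B) + 1))"
  have d: "d > 0"
    using r(1) by (simp add: d_def)
  have "\<exists>y N. y \<in> abs_sums X I N \<and> dist y b < d" for b
    using closure_approachable[of b "\<Union>M. abs_sums X I M"] dense d by blast
  then obtain y N where y: "\<And>b. y b \<in> abs_sums X I (N b)" "\<And>b. dist (y b) b < d"
    by metis
  \<comment> \<open>The absolute value supplies the sign needed for monotonicity of the products
    below.\<close>
  have y': "y b \<in> abs_sums X I \<bar>N b\<bar>" for b
    using y(1)[of b] abs_sums_mono[OF abs_ge_self[of "N b"]] by blast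
  define K where "K = (\<Sum>b\<in>B. 2 * real n * \<bar>N b\<bar>)"
  have approx: "\<exists>s\<in>abs_sums X I (real n + real n + K). norm (v - s) < r / 2" if v: "norm v < r" for v
  proof -
    have r8: "r / 8 > 0"
      using r(1) by simp
    \<comment> \<open>Both \<open>a\<close> and \<open>a + v\<close> are approximated from
      \<open>A n\<close>, so that the centre cancels in \<open>p - q\<close>.\<close>
    have "a \<in> closure (A n)" "a + v \<in> closure (A n)"
      using r v by (auto simp: subset_iff dist_norm)
    then obtain p q where p: "p \<in> A n" "dist p (a + v) < r / 8" and q: "q \<in> A n" "dist q a < r / 8"
      using r8 unfolding closure_approachable by metis
    obtain s c where s: "p = s + (\<Sum>b\<in>B. scale (c b) b)" "s \<in> abs_sums X I (real n)"
        "\<forall>b\<in>B. norm (c b) \<le> real n"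
      using p(1) unfolding A_def by blast
    obtain s' c' where s': "q = s' + (\<Sum>b\<in>B. scale (c' b) b)" "s' \<in> abs_sums X I (real n)"
        "\<forall>b\<in>B. norm (c' b) \<le> real n"
      using q(1) unfolding A_def by blast
    define g where "g b = c b - c' b" for b
    have g: "norm (g b) \<le> 2 * real n" if "b \<in> B" for b
      using norm_triangle_ineq4[of "c b" "c' b"] s(3) s'(3) that unfolding g_def by fastforce
    \<comment> \<open>This is \<open>p - q\<close> with each \<open>b\<close> replaced by its
      approximant \<open>y b\<close>.\<close>
    define t where "t = (s - s') + (\<Sum>b\<in>B. scale (g b) (y b))"
    have "t \<in> abs_sums X I ((real n + real n) + (\<Sum>b\<in>B. norm (g b) * \<bar>N b\<bar>))"
      unfolding t_def using X' B s(2) s'(2) y'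
      by (intro abs_sums_add abs_sums_diff abs_sums_lincomb) auto
    moreover have "(\<Sum>b\<in>B. norm (g b) * \<bar>N b\<bar>) \<le> K"
      unfolding K_def using g by (intro sum_mono mult_right_mono) auto
    ultimately have "t \<in> abs_sums X I (real n + real n + K)"
      using abs_sums_mono[of "(real n + real n) + (\<Sum>b\<in>B. norm (g b) * \<bar>N b\<bar>)" "real n + real n + K"]
      by auto
    moreover have "norm (v - t) < r / 2"
    proof -
      have eq: "p - q - t = (\<Sum>b\<in>B. scale (g b) (b - y b))"
        by (simp add: s(1) s'(1) t_def g_def scale_left_diff_distrib scale_right_diff_distrib
            sum_subtractf)
      have "norm (p - q - t) \<le> (\<Sum>b\<in>B. norm (scale (g b) (b - y b)))"
        unfolding eq by (rule norm_sum)
      also have "\<dots> \<le> (\<Sum>b\<in>B. 2 * (real n + 1) * d)"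
      proof (rule sum_mono)
        fix b assume "b \<in> B"
        then show "norm (scale (g b) (b - y b)) \<le> 2 * (real n + 1) * d"
          unfolding norm_scale using g[of b] y(2)[of b] d
          by (intro mult_mono) (auto simp: dist_norm norm_minus_commute)
      qed
      also have "\<dots> = r / 4 * (real (card B) / (real (card B) + 1))"
        unfolding d_def by (simp add: divide_simps) (simp add: algebra_simps)
      also have "\<dots> \<le> r / 4 * 1"
        using r(1) by (intro mult_left_mono) (auto simp: divide_simps)
      finally have "norm (p - q - t) \<le> r / 4"
        by simp
      \<comment> \<open>The error splits into the replacement of \<open>B\<close>, at most
        \<open>r / 4\<close>, and the approximation of \<open>a + v\<close> and \<open>a\<close>,
        less than \<open>r / 4\<close>.\<close>
      moreover have "v - t = (p - q - t) - ((p - (a + v)) - (q - a))"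
        by simp
      moreover have "norm ((p - (a + v)) - (q - a)) < r / 4"
        using norm_triangle_ineq4[of "p - (a + v)" "q - a"] p(2) q(2) by (simp add: dist_norm)
      ultimately show ?thesis
        using norm_triangle_ineq4[of "p - q - t" "(p - (a + v)) - (q - a)"] by simp
    qed
    ultimately show ?thesis
      by blast
  qed
  have "w \<in> (\<Union>M. abs_sums X I M)" for w
  proof -
    \<comment> \<open>Rescaling by \<open>h\<close> brings \<open>w\<close> into the ball; the added
      one covers \<open>w = 0\<close>.\<close>
    define h where "h = r / (2 * (norm w + 1))"
    have nw: "norm w + 1 > 0"
      using norm_ge_zero[of w] by linarith
    then have h: "h > 0" "norm (h *\<^sub>R w) < r"
      using r(1) by (auto simp: h_def divide_simps)
    have "h *\<^sub>R w \<in> abs_sums X I (2 * (real n + real n + K))"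
      using X approx h(2) by (rule ball_subset_abs_sums)
    from abs_sums_scaleR[OF X' this, of "1 / h"] show ?thesis
      using h(1) by auto
  qed
  then show ?thesis
    by blast
qed

end

section \<open>Removing finitely many finite-dimensional subspaces\<close>

theorem theorem6p4:
  fixes scale :: "'k::{real_normed_field, euclidean_space} \<Rightarrow> 'a::banach \<Rightarrow> 'a"
    and X :: "'i \<Rightarrow> 'a set"
    and \<Lambda> \<Lambda>' :: "'i set"
  assumes "banach_space_over scale"
    and "\<Lambda> \<noteq> {}"
    and "\<And>l. l \<in> \<Lambda> \<Longrightarrow> banach_space_over.closed_subspace scale (X l)"
    and "banach_space_over.ARFS scale X \<Lambda>"
    and "\<Lambda>' \<subseteq> \<Lambda>"
    and "finite \<Lambda>'"
    and "\<And>l. l \<in> \<Lambda>' \<Longrightarrow> banach_space_over.finite_dimensional scale (X l)"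
  shows "banach_space_over.ARFS scale X (\<Lambda> - \<Lambda>') \<longleftrightarrow>
    closure (module.span scale (\<Union>l\<in>\<Lambda> - \<Lambda>'. X l)) = UNIV"
proof -
  interpret banach_space_over scale
    by fact
  have X: "\<And>l. l \<in> \<Lambda> - \<Lambda>' \<Longrightarrow> closed_subspace (X l)"
    using assms(3) by blast
  show ?thesis
  proof
    assume "ARFS X (\<Lambda> - \<Lambda>')"
    then show "closure (span (\<Union>l\<in>\<Lambda> - \<Lambda>'. X l)) = UNIV"
      using abs_sums_subset_closure_span unfolding ARFS_iff_abs_sums by blast
  next
    assume dense: "closure (span (\<Union>l\<in>\<Lambda> - \<Lambda>'. X l)) = UNIV"
    obtain B where B: "finite B" "(\<Union>M. abs_sums X \<Lambda>' M) \<subseteq> span B"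
      by (rule finite_dimensional_abs_sums_subset[OF assms(6,7)])
    have "\<exists>s M. s \<in> abs_sums X (\<Lambda> - \<Lambda>') M \<and> v - s \<in> span B" for v
    proof -
      \<comment> \<open>In a representation over \<open>\<Lambda>\<close>, the part over
        \<open>\<Lambda>'\<close> lies in \<open>span B\<close>.\<close>
      obtain M where "v \<in> abs_sums X \<Lambda> M"
        using assms(4) unfolding ARFS_iff_abs_sums by blast
      with assms(5) obtain s t N N' where
        "v = s + t" "s \<in> abs_sums X (\<Lambda> - \<Lambda>') N" "t \<in> abs_sums X \<Lambda>' N'"
        by (rule abs_sums_split)
      moreover from this have "v - s \<in> span B"
        using B(2) by auto
      ultimately show ?thesis
        by blast
    qed
    \<comment> \<open>Density passes from the span to the larger set of absolutely convergent
      sums.\<close>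
    moreover have "span (\<Union>l\<in>\<Lambda> - \<Lambda>'. X l) \<subseteq> (\<Union>M. abs_sums X (\<Lambda> - \<Lambda>') M)"
      using X by (intro span_subset_abs_sums) (simp add: closed_subspace_def)
    then have "closure (\<Union>M. abs_sums X (\<Lambda> - \<Lambda>') M) = UNIV"
      using dense closure_mono by blast
    ultimately have "(\<Union>M. abs_sums X (\<Lambda> - \<Lambda>') M) = UNIV"
      using X B(1) by (intro dense_abs_sums_eq_UNIV) auto
    then show "ARFS X (\<Lambda> - \<Lambda>')"
      using X by (simp add: ARFS_iff_abs_sums)
  qed
qed

end
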